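(* Let $(x_k)_{k\ge0}$ be a bounded sequence generated by algorithm CPG or CGD (see context) under the assumptions stated there, with $i_k$ chosen cyclically, and let $X(x_0)$ be the set of limit points of $(x_k)_{k\ge0}$. Assume that for some constant $C>0$, $$F(x_k)-F(x_{k+N})\ge C\|\nabla F(x_k)\|^2\qquad\forall k\ge0,$$ and that $F$ satisfies the KL property with exponent $q>1$ on $X(x_0)$, with constant value $F_*$: $F\equiv F_*$ on $X(x_0)$ and there are $\gamma,\epsilon,\sigma_q>0$ such that $$F(x)-F_*\le\sigma_q\|\nabla F(x)\|^q\quad\text{for all }x\text{ with }\operatorname{dist}(x,X(x_0))\le\gamma,\ F_*<F(x)<F_*+\epsilon .$$ Then there exists $\bar k=\bar k_{\epsilon,\gamma}>0$ such that: (i) if $q\in(1,2)$, for all $k\ge\bar k$, $$F(x_{kN})-F_*\le\frac{F(x_{\bar kN})-F_*}{\left(\frac{2-q}{q}\,C\,\sigma_q^{-\frac2q}\,(F(x_{\bar kN})-F_* )^{\frac{2-q}{q}}\,(k-\bar k)+1\right)^{\frac{q}{2-q}}};$$ (ii) if $q=2$, for all $k\ge\bar k$, $$F(x_{kN})-F_*\le(1-C\sigma_2^{-1})^{k-\bar k}\,\big(F(x_{\bar kN})-F_*\big);$$ (iii) if $q>2$, for all $k>\bar k$ with $F(x_{kN})>F_*$, $$F(x_{kN})-F_*\le\left(\frac{1}{1+C\sigma_q^{-\frac2q}(F(x_{kN})-F_* )^{\frac2q-1}}\right)\big(F(x_{(k-1)N})-F_*\big).$$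
   Context: Setting: $F=f+\psi$ with $f,\psi:\mathbb{R}^n\to\mathbb{R}$, $f$ differentiable, both possibly nonconvex. $U=[U_1,\dots,U_N]\in\mathbb{R}^{n\times n}$ is a column permutation of $I_n$, split into $U_i\in\mathbb{R}^{n\times n_i}$, $\sum_i n_i=n$. Norms are Euclidean / induced operator norms. Cyclic choice: $i_k=(k \bmod N)+1$. Assumptions. A.1: $\|U_i^T(\nabla f(x+U_ih)-\nabla f(x))\|\le L_i\|h\|$ for all $h,x,i$. A.2: $\psi$ is twice continuously differentiable. A.3: $F$ attains its minimum $F^*>-\infty$. Algorithm CPG: fix $\eta_i>0$; $H_{f,U_i}=\frac{L_i+\eta_i}{2}$ if $d\mapsto\psi(x+U_id)$ is convex for all $x,i$, else $H_{f,U_i}=L_i+\eta_i$. Given $x_0$, for $k\ge0$: choose $i_k$; take $d_k\in\arg\min_{d\in\mathbb{R}^{n_{i_k}}}f(x_k)+\langle U_{i_k}^T\nabla f(x_k),d\rangle+\frac{H_{f,U_{i_k}}}{2}\|d\|^2+\psi(x_k+U_{i_k}d)$ (assumed to exist); $x_{k+1}=x_k+U_{i_k}d_k$. Algorithm CGD: fix $\eta_i>0$; $H_{f,U_i}=\frac{L_i+\eta_i}{2}$. Given $x_0$, for $k\ge0$: choose $i_k$, compute $H_{F_k}$ by one of the rules below, $d_k=-\frac1{H_{F_k}}U_{i_k}^T\nabla F(x_k)$, $x_{k+1}=x_k+U_{i_k}d_k$. The same rule is used for all $k$, and $\psi$ satisfies the assumption attached to it: Rule 1 (A.4 and A.5):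 $\alpha_k\ge0$ root of $\frac{L_\psi}{6}\alpha^2+(\frac{H_\psi}{2}\|x_k\|^p+H_{f,U_{i_k}})\alpha=\|U_{i_k}^T\nabla F(x_k)\|$; $H_{F_k}=\frac{H_\psi}{2}\|x_k\|^p+\frac{L_\psi}{6}\alpha_k+H_{f,U_{i_k}}$. Rule 2 (A.4): $\alpha_k\ge0$ root of $2^{p-1}H_\psi\alpha^{p+1}+(2^{p-1}H_\psi\|x_k\|^p+H_{f,U_{i_k}})\alpha=\|U_{i_k}^T\nabla F(x_k)\|$; $H_{F_k}=2^{p-1}H_\psi\|x_k\|^p+2^{p-1}H_\psi\alpha_k^p+H_{f,U_{i_k}}$. Rule 3 (A.5): $\alpha_k\ge0$ root of $\frac{L_\psi}{6}\alpha^2+(\frac{L_\psi}{2}\|x_k-x_0\|+\frac12\|\nabla^2\psi(x_0)\|+H_{f,U_{i_k}})\alpha=\|U_{i_k}^T\nabla F(x_k)\|$; $H_{F_k}=\frac{L_\psi}{2}\|x_k-x_0\|+\frac12\|\nabla^2\psi(x_0)\|+\frac{L_\psi}{6}\alpha_k+H_{f,U_{i_k}}$. Rule 4 (A.6): $H_{F_k}=H_{f,U_{i_k}}$. Here A.4: $\|U_i^T\nabla^2\psi(y)U_i\|\le H_\psi\|y\|^p$ for all $y,i$ ($H_\psi>0$, integer $p\ge1$); A.5: $\|\nabla^2\psi(y)-\nabla^2\psi(x)\|\le L_\psi\|y-x\|$ for all $x,y$ ($L_\psi>0$); A.6: $\psi(x+U_id)\le\psi(x)+\langle U_i^T\nabla\psi(x),d\rangle$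 for all $x,d,i$. *)

theory Defs
  imports "HOL-Analysis.Analysis"
begin

section \<open>Gradients and Hessians\<close>

definition grad :: "(real^'n \<Rightarrow> real) \<Rightarrow> real^'n \<Rightarrow> real^'n" where
  "grad f x = (THE g. GDERIV f x :> g)"

definition hess :: "(real^'n \<Rightarrow> real) \<Rightarrow> real^'n \<Rightarrow> real^'n^'n" where
  "hess f x = matrix (frechet_derivative (grad f) (at x))"

definition twice_cont_diff :: "(real^'n \<Rightarrow> real) \<Rightarrow> bool" where
  "twice_cont_diff f \<longleftrightarrow>
     (\<forall>x. f differentiable (at x)) \<and> (\<forall>x. grad f differentiable (at x)) \<and>
     continuous_on UNIV (hess f)"

definition opnorm :: "real^'n^'m \<Rightarrow> real" where
  "opnorm A = onorm (\<lambda>v. A *v v)"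


section \<open>Coordinate blocks\<close>

text \<open>
  The block dimensions \<open>n\<^sub>i\<close> vary with \<open>i\<close>, so they cannot be types. The column indices
  of \<open>U\<close> are split into sets \<open>J 1, \<dots>, J N\<close> with \<open>n\<^sub>i = card (J i) > 0\<close>; these sets need
  not be consecutive, as \<open>'n\<close> carries no order and the columns of \<open>U\<close> are arbitrarily permuted.
  The space of dimension \<open>n\<^sub>i\<close> is represented by the vectors supported on \<open>J i\<close>,
  and the \<open>n \<times> n\<^sub>i\<close> matrix \<open>U\<^sub>i\<close> by the \<open>n \<times> n\<close> matrix that has the columns of \<open>U\<close> at the
  positions in \<open>J i\<close> and zero columns elsewhere. This zero padding changes neither Euclidean norms
  and inner products nor the operator norm of \<open>U\<^sub>i\<^sup>T A U\<^sub>i\<close>, and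
  the range of \<open>U\<^sub>i\<^sup>T\<close> lies in the space of vectors supported on \<open>J i\<close>.
\<close>

definition column_permutation_of_identity :: "real^'n^'n \<Rightarrow> bool" where
  "column_permutation_of_identity U \<longleftrightarrow>
     (\<exists>\<pi>. bij \<pi> \<and> (\<forall>j. column j U = column (\<pi> j) (mat 1)))"

definition column_split :: "(nat \<Rightarrow> 'n set) \<Rightarrow> nat \<Rightarrow> bool" where
  "column_split J N \<longleftrightarrow>
     disjoint_family_on J {1..N} \<and> (\<Union>i\<in>{1..N}. J i) = UNIV \<and> (\<forall>i\<in>{1..N}. J i \<noteq> {})"

definition block_space :: "'n set \<Rightarrow> (real^'n) set" where
  "block_space S = {d. \<forall>j. j \<notin> S \<longrightarrow> d $ j = 0}"

definition column_block :: "real^'n^'n \<Rightarrow> 'n set \<Rightarrow> real^'n^'n" where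
  "column_block U S = (\<chi> a j. if j \<in> S then U $ a $ j else 0)"

definition cyclic_index :: "nat \<Rightarrow> nat \<Rightarrow> nat" where
  "cyclic_index N k = k mod N + 1"


section \<open>Assumptions on the objective\<close>

definition assumption_A1 ::
  "real^'n^'n \<Rightarrow> (nat \<Rightarrow> 'n set) \<Rightarrow> nat \<Rightarrow> (real^'n \<Rightarrow> real) \<Rightarrow> (nat \<Rightarrow> real) \<Rightarrow> bool" where
  "assumption_A1 U J N f L \<longleftrightarrow>
     (\<forall>i\<in>{1..N}. \<forall>x. \<forall>h\<in>block_space (J i).
        norm (transpose (column_block U (J i)) *v (grad f (x + column_block U (J i) *v h) - grad f x))
          \<le> L i * norm h)"

definition assumption_A3 :: "(real^'n \<Rightarrow> real) \<Rightarrow> bool" where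
  "assumption_A3 F \<longleftrightarrow> (\<exists>z. \<forall>x. F z \<le> F x)"

definition assumption_A4 ::
  "real^'n^'n \<Rightarrow> (nat \<Rightarrow> 'n set) \<Rightarrow> nat \<Rightarrow> (real^'n \<Rightarrow> real) \<Rightarrow> real \<Rightarrow> nat \<Rightarrow> bool" where
  "assumption_A4 U J N \<psi> H\<psi> p \<longleftrightarrow> 0 < H\<psi> \<and> 1 \<le> p \<and>
     (\<forall>i\<in>{1..N}. \<forall>y.
        opnorm (transpose (column_block U (J i)) ** hess \<psi> y ** column_block U (J i))
          \<le> H\<psi> * norm y ^ p)"

definition assumption_A5 :: "(real^'n \<Rightarrow> real) \<Rightarrow> real \<Rightarrow> bool" where
  "assumption_A5 \<psi> L\<psi> \<longleftrightarrow> 0 < L\<psi> \<and>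
     (\<forall>x y. opnorm (hess \<psi> y - hess \<psi> x) \<le> L\<psi> * norm (y - x))"

definition assumption_A6 ::
  "real^'n^'n \<Rightarrow> (nat \<Rightarrow> 'n set) \<Rightarrow> nat \<Rightarrow> (real^'n \<Rightarrow> real) \<Rightarrow> bool" where
  "assumption_A6 U J N \<psi> \<longleftrightarrow>
     (\<forall>i\<in>{1..N}. \<forall>x. \<forall>d\<in>block_space (J i).
        \<psi> (x + column_block U (J i) *v d)
          \<le> \<psi> x + (transpose (column_block U (J i)) *v grad \<psi> x) \<bullet> d)"


section \<open>Algorithm CPG\<close>

definition convex_along_blocks ::
  "real^'n^'n \<Rightarrow> (nat \<Rightarrow> 'n set) \<Rightarrow> nat \<Rightarrow> (real^'n \<Rightarrow> real) \<Rightarrow> bool" where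
  "convex_along_blocks U J N \<psi> \<longleftrightarrow>
     (\<forall>i\<in>{1..N}. \<forall>x. convex_on (block_space (J i)) (\<lambda>d. \<psi> (x + column_block U (J i) *v d)))"

definition cpg_Hf ::
  "real^'n^'n \<Rightarrow> (nat \<Rightarrow> 'n set) \<Rightarrow> nat \<Rightarrow> (real^'n \<Rightarrow> real) \<Rightarrow> (nat \<Rightarrow> real) \<Rightarrow> (nat \<Rightarrow> real) \<Rightarrow>
   nat \<Rightarrow> real" where
  "cpg_Hf U J N \<psi> L \<eta> i =
     (if convex_along_blocks U J N \<psi> then (L i + \<eta> i) / 2 else L i + \<eta> i)"

definition cpg_sequence ::
  "real^'n^'n \<Rightarrow> (nat \<Rightarrow> 'n set) \<Rightarrow> nat \<Rightarrow> (real^'n \<Rightarrow> real) \<Rightarrow> (real^'n \<Rightarrow> real) \<Rightarrow>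
   (nat \<Rightarrow> real) \<Rightarrow> (nat \<Rightarrow> real) \<Rightarrow> (nat \<Rightarrow> nat) \<Rightarrow> (nat \<Rightarrow> real^'n) \<Rightarrow> bool" where
  "cpg_sequence U J N f \<psi> L \<eta> \<iota> x \<longleftrightarrow>
     (\<exists>d. \<forall>k. let V = column_block U (J (\<iota> k)) in
        is_arg_min
          (\<lambda>e. f (x k) + (transpose V *v grad f (x k)) \<bullet> e
               + cpg_Hf U J N \<psi> L \<eta> (\<iota> k) / 2 * (norm e)\<^sup>2 + \<psi> (x k + V *v e))
          (\<lambda>e. e \<in> block_space (J (\<iota> k))) (d k) \<and>
        x (Suc k) = x k + V *v d k)"


section \<open>Algorithm CGD\<close>

definition cgd_Hf :: "(nat \<Rightarrow> real) \<Rightarrow> (nat \<Rightarrow> real) \<Rightarrow> nat \<Rightarrow> real" where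
  "cgd_Hf L \<eta> i = (L i + \<eta> i) / 2"

text \<open>
  In the rules, \<open>hf k\<close> stands for \<open>H\<close> with index \<open>f, U\<^bsub>i\<^esub>\<close> for the block \<open>i\<close> used at step \<open>k\<close>,
  \<open>G k\<close> for the norm of the corresponding partial gradient of \<open>F\<close> at \<open>x k\<close>, and \<open>HF k\<close> for the
  resulting inverse step size.
\<close>

definition cgd_rule1 ::
  "real \<Rightarrow> nat \<Rightarrow> real \<Rightarrow> (nat \<Rightarrow> real) \<Rightarrow> (nat \<Rightarrow> real) \<Rightarrow> (nat \<Rightarrow> real^'n) \<Rightarrow> (nat \<Rightarrow> real) \<Rightarrow> bool" where
  "cgd_rule1 H\<psi> p L\<psi> hf G x HF \<longleftrightarrow>
     (\<forall>k. \<exists>\<alpha>\<ge>0.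
        L\<psi> / 6 * \<alpha>\<^sup>2 + (H\<psi> / 2 * norm (x k) ^ p + hf k) * \<alpha> = G k \<and>
        HF k = H\<psi> / 2 * norm (x k) ^ p + L\<psi> / 6 * \<alpha> + hf k)"

definition cgd_rule2 ::
  "real \<Rightarrow> nat \<Rightarrow> (nat \<Rightarrow> real) \<Rightarrow> (nat \<Rightarrow> real) \<Rightarrow> (nat \<Rightarrow> real^'n) \<Rightarrow> (nat \<Rightarrow> real) \<Rightarrow> bool" where
  "cgd_rule2 H\<psi> p hf G x HF \<longleftrightarrow>
     (\<forall>k. \<exists>\<alpha>\<ge>0.
        2 ^ (p - 1) * H\<psi> * \<alpha> ^ (p + 1) + (2 ^ (p - 1) * H\<psi> * norm (x k) ^ p + hf k) * \<alpha> = G k \<and>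
        HF k = 2 ^ (p - 1) * H\<psi> * norm (x k) ^ p + 2 ^ (p - 1) * H\<psi> * \<alpha> ^ p + hf k)"

definition cgd_rule3 ::
  "(real^'n \<Rightarrow> real) \<Rightarrow> real \<Rightarrow> (nat \<Rightarrow> real) \<Rightarrow> (nat \<Rightarrow> real) \<Rightarrow> (nat \<Rightarrow> real^'n) \<Rightarrow>
   (nat \<Rightarrow> real) \<Rightarrow> bool" where
  "cgd_rule3 \<psi> L\<psi> hf G x HF \<longleftrightarrow>
     (\<forall>k. \<exists>\<alpha>\<ge>0.
        L\<psi> / 6 * \<alpha>\<^sup>2
          + (L\<psi> / 2 * norm (x k - x 0) + 1 / 2 * opnorm (hess \<psi> (x 0)) + hf k) * \<alpha> = G k \<and>
        HF k = L\<psi> / 2 * norm (x k - x 0) + 1 / 2 * opnorm (hess \<psi> (x 0)) + L\<psi> / 6 * \<alpha> + hf k)"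

definition cgd_rule4 :: "(nat \<Rightarrow> real) \<Rightarrow> (nat \<Rightarrow> real) \<Rightarrow> bool" where
  "cgd_rule4 hf HF \<longleftrightarrow> (\<forall>k. HF k = hf k)"

text \<open>
  One rule is used for all \<open>k\<close>, together with the assumption on \<open>\<psi>\<close> attached to it. Constants that
  do not occur in the rule in use are irrelevant.
\<close>

definition cgd_sequence ::
  "real^'n^'n \<Rightarrow> (nat \<Rightarrow> 'n set) \<Rightarrow> nat \<Rightarrow> (real^'n \<Rightarrow> real) \<Rightarrow> (real^'n \<Rightarrow> real) \<Rightarrow>
   (nat \<Rightarrow> real) \<Rightarrow> (nat \<Rightarrow> real) \<Rightarrow> real \<Rightarrow> nat \<Rightarrow> real \<Rightarrow> (nat \<Rightarrow> nat) \<Rightarrow> (nat \<Rightarrow> real^'n) \<Rightarrow> bool" where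
  "cgd_sequence U J N f \<psi> L \<eta> H\<psi> p L\<psi> \<iota> x \<longleftrightarrow>
     (let V = (\<lambda>k. column_block U (J (\<iota> k)));
          g = (\<lambda>k. transpose (V k) *v grad (\<lambda>z. f z + \<psi> z) (x k));
          hf = (\<lambda>k. cgd_Hf L \<eta> (\<iota> k));
          G = (\<lambda>k. norm (g k))
      in \<exists>HF.
        (assumption_A4 U J N \<psi> H\<psi> p \<and> assumption_A5 \<psi> L\<psi> \<and> cgd_rule1 H\<psi> p L\<psi> hf G x HF \<or>
         assumption_A4 U J N \<psi> H\<psi> p \<and> cgd_rule2 H\<psi> p hf G x HF \<or>
         assumption_A5 \<psi> L\<psi> \<and> cgd_rule3 \<psi> L\<psi> hf G x HF \<or>
         assumption_A6 U J N \<psi> \<and> cgd_rule4 hf HF) \<and>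
        (\<forall>k. x (Suc k) = x k + V k *v (- (1 / HF k) *\<^sub>R g k)))"


section \<open>Limit points and the KL property\<close>

text \<open>
  Limits of subsequences, as opposed to accumulation points of the range: a sequence that is
  eventually constant has a limit point.
\<close>

definition limit_points :: "(nat \<Rightarrow> real^'n) \<Rightarrow> (real^'n) set" where
  "limit_points x = {l. \<exists>r. strict_mono r \<and> (x \<circ> r) \<longlonglongrightarrow> l}"

definition KL_property ::
  "(real^'n \<Rightarrow> real) \<Rightarrow> (real^'n) set \<Rightarrow> real \<Rightarrow> real \<Rightarrow> real \<Rightarrow> real \<Rightarrow> real \<Rightarrow> bool" where
  "KL_property F X Fstar q \<gamma> \<epsilon> \<sigma> \<longleftrightarrow>
     0 < \<gamma> \<and> 0 < \<epsilon> \<and> 0 < \<sigma> \<and> (\<forall>z\<in>X. F z = Fstar) \<and>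
     (\<forall>z. infdist z X \<le> \<gamma> \<and> Fstar < F z \<and> F z < Fstar + \<epsilon> \<longrightarrow>
        F z - Fstar \<le> \<sigma> * norm (grad F z) powr q)"

end

theory Submission
  imports Defs
begin

text \<open>
  Along every \<open>N\<close>-th iterate the gap \<open>\<Delta> k = F (x (k * N)) - Fstar\<close> decreases to \<open>0\<close>,
  because it is monotone and vanishes at the limit points. Eventually the iterates enter the region
  where the KL inequality holds, and together with the descent condition it gives
  \<open>\<Delta> k - \<Delta> (k + 1) \<ge> c * \<Delta> k powr (2 / q)\<close> with \<open>c = C * \<sigma> powr (- 2 / q)\<close>.
  The three rates follow from this recursion alone: for \<open>q < 2\<close> the quantity \<open>\<Delta> powr (- \<zeta>)\<close>
  with \<open>\<zeta> = 2 / q - 1\<close> grows by at least \<open>\<zeta> * c\<close> per step, for \<open>q = 2\<close> the recursion is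
  linear, and for \<open>q > 2\<close> one replaces \<open>\<Delta> k\<close> by the smaller \<open>\<Delta> (k + 1)\<close> on the right-hand side.
\<close>

text \<open>Bernoulli's inequality for a negative real exponent, from
  \<open>ln u \<le> u - 1\<close> and \<open>1 + u \<le> exp u\<close>. It gives the growth per step
  of the negative power of the gap.\<close>

lemma one_minus_powr_neg_ge:
  fixes t s :: real
  assumes "0 \<le> s" "t < 1"
  shows "1 + s * t \<le> (1 - t) powr (- s)"
proof -
  have "1 + s * t \<le> 1 + (- s) * ln (1 - t)"
    using mult_left_mono[OF ln_le_minus_one[of "1 - t"], of s] assms by simp
  also have "\<dots> \<le> exp ((- s) * ln (1 - t))"
    by (rule exp_ge_add_one_self)
  also have "\<dots> = (1 - t) powr (- s)"
    using assms by (simp add: powr_def)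
  finally show ?thesis .
qed

lemma sublinear_rate:
  fixes \<Delta> :: "nat \<Rightarrow> real"
  assumes nonneg: "\<And>k. 0 \<le> \<Delta> k" and "0 < s" "0 < c"
    and rec: "\<And>k. \<Delta> k - \<Delta> (Suc k) \<ge> c * \<Delta> k powr (1 + s)"
  shows "\<Delta> k \<le> \<Delta> 0 / (s * c * \<Delta> 0 powr s * real k + 1) powr (1 / s)"
proof (cases "\<Delta> k = 0")
  case True
  then show ?thesis using nonneg[of 0] by simp
next
  case False
  have "decseq \<Delta>"
  proof (rule decseq_SucI)
    fix m
    have "0 \<le> c * \<Delta> m powr (1 + s)" using \<open>0 < c\<close> by simp
    then show "\<Delta> (Suc m) \<le> \<Delta> m" using rec[of m] by linarith
  qed
  \<comment> \<open>Since \<open>0 powr (- s) = 0\<close>, the growth estimate is meaningful only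
    while the gap is positive. Monotonicity carries positivity at \<open>k\<close> back to all
    earlier indices.\<close>
  have pos: "0 < \<Delta> m" if "m \<le> k" for m
    using False nonneg[of k] decseqD[OF \<open>decseq \<Delta>\<close> that] by linarith
  have step: "\<Delta> m powr (- s) + s * c \<le> \<Delta> (Suc m) powr (- s)" if "Suc m \<le> k" for m
  proof -
    have p: "0 < \<Delta> m" "0 < \<Delta> (Suc m)" using pos that by auto
    \<comment> \<open>\<open>t\<close> is the relative decrease that the recursion guarantees; it
      stays below \<open>1\<close> because the next gap is still positive.\<close>
    define t where "t = c * \<Delta> m powr s"
    have le: "\<Delta> (Suc m) \<le> \<Delta> m * (1 - t)"
      using rec[of m] p by (simp add: t_def powr_add algebra_simps)
    with p have "t < 1"
      by (metis diff_gt_0_iff_gt less_le_trans zero_less_mult_pos)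
    have "\<Delta> m powr (- s) + s * c = \<Delta> m powr (- s) * (1 + s * t)"
      using p by (simp add: t_def powr_minus field_simps)
    also have "\<dots> \<le> \<Delta> m powr (- s) * (1 - t) powr (- s)"
      using one_minus_powr_neg_ge[of s t] \<open>0 < s\<close> \<open>t < 1\<close> by (intro mult_left_mono) auto
    also have "\<dots> = (\<Delta> m * (1 - t)) powr (- s)"
      using p \<open>t < 1\<close> by (simp add: powr_mult)
    also have "\<dots> \<le> \<Delta> (Suc m) powr (- s)"
      using le p \<open>0 < s\<close> by (intro powr_mono2') auto
    finally show ?thesis .
  qed
  have sum: "\<Delta> 0 powr (- s) + s * c * real m \<le> \<Delta> m powr (- s)" if "m \<le> k" for m
    using that
  proof (induction m)
    case (Suc m)
    then show ?case using step[of m] by (simp add: algebra_simps)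
  qed simp
  have p: "0 < \<Delta> 0" "0 < \<Delta> k" using pos by auto
  define B where "B = s * c * \<Delta> 0 powr s * real k + 1"
  have "0 < B" unfolding B_def using \<open>0 < s\<close> \<open>0 < c\<close> by (intro add_nonneg_pos) auto
  have "\<Delta> 0 powr (- s) * B = \<Delta> 0 powr (- s) + s * c * real k"
    using p by (simp add: B_def powr_minus field_simps)
  then have "\<Delta> 0 powr (- s) * B \<le> \<Delta> k powr (- s)" using sum[of k] by simp
  \<comment> \<open>The power \<open>- 1 / s\<close> undoes \<open>- s\<close> and reverses the
    order; in the direction shown it acts on the telescoped growth bound.\<close>
  then have "(\<Delta> k powr (- s)) powr (- 1 / s) \<le> (\<Delta> 0 powr (- s) * B) powr (- 1 / s)"
    using p \<open>0 < B\<close> \<open>0 < s\<close> by (intro powr_mono2') auto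
  moreover have cancel: "(d powr (- s)) powr (- 1 / s) = d" if "0 < d" for d
    using that \<open>0 < s\<close> by (simp add: powr_powr)
  moreover have "(\<Delta> 0 powr (- s) * B) powr (- 1 / s) = \<Delta> 0 / B powr (1 / s)"
    using cancel[OF p(1)] \<open>0 < B\<close> powr_minus_divide[of B "1 / s"] by (simp add: powr_mult)
  ultimately show ?thesis using p by (simp add: B_def)
qed

text \<open>Induction on \<open>k\<close> works for \<open>0 \<le> r\<close>. In the application
  \<open>r = 1 - C * inverse \<sigma>\<close> is not known to be nonnegative, but a negative
  \<open>r\<close> forces every gap to vanish.\<close>

lemma linear_rate:
  fixes \<Delta> :: "nat \<Rightarrow> real"
  assumes nonneg: "\<And>k. 0 \<le> \<Delta> k"
    and rec: "\<And>k. \<Delta> (Suc k) \<le> r * \<Delta> k"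
  shows "\<Delta> k \<le> r ^ k * \<Delta> 0"
proof (cases "0 \<le> r")
  case True
  show ?thesis
  proof (induction k)
    case (Suc k)
    have "\<Delta> (Suc k) \<le> r * \<Delta> k" by (rule rec)
    also have "\<dots> \<le> r * (r ^ k * \<Delta> 0)" using Suc True by (rule mult_left_mono)
    finally show ?case by (simp add: mult.assoc)
  qed simp
next
  case False
  have "\<Delta> m = 0" for m
  proof -
    have "0 \<le> r * \<Delta> m" using nonneg[of "Suc m"] rec[of m] by linarith
    then show ?thesis using False nonneg[of m] by (simp add: zero_le_mult_iff)
  qed
  then show ?thesis by simp
qed

text \<open>A single step rather than a closed form, because the contraction factor depends on the
  new gap \<open>b\<close>.\<close>

lemma superlinear_rate:
  fixes a b c s :: real
  assumes "0 < b" "0 < c" "0 \<le> s" and rec: "a - b \<ge> c * a powr s"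
  shows "b \<le> 1 / (1 + c * b powr (s - 1)) * a"
proof -
  have "0 \<le> c * a powr s" using assms by simp
  then have "b \<le> a" using rec by linarith
  then have "c * b powr s \<le> c * a powr s"
    using assms by (intro mult_left_mono powr_mono2) auto
  then have "b + c * b powr s \<le> a" using rec by linarith
  moreover have "b powr s = b powr (s - 1) * b"
    using powr_add[of b "s - 1" 1] \<open>0 < b\<close> by simp
  ultimately have "b * (1 + c * b powr (s - 1)) \<le> a" by (simp add: algebra_simps)
  moreover have "0 < 1 + c * b powr (s - 1)"
    using \<open>0 < c\<close> by (intro add_pos_nonneg) auto
  ultimately show ?thesis by (simp add: pos_le_divide_eq)
qed

text \<open>Bolzano-Weierstrass along a prescribed subsequence \<open>r\<close>: a limit along
  \<open>r \<circ> s\<close> is also a limit point of \<open>x\<close> itself.\<close>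

lemma bounded_subseq_limit_point:
  fixes x :: "nat \<Rightarrow> real^'n" and r :: "nat \<Rightarrow> nat"
  assumes "bounded (range x)" "strict_mono r"
  obtains s l where "strict_mono s" "(x \<circ> r \<circ> s) \<longlonglongrightarrow> l" "l \<in> limit_points x"
proof -
  have "bounded (range (x \<circ> r))"
    using assms(1) by (rule bounded_subset) auto
  then obtain l s where sl: "strict_mono s" "((x \<circ> r) \<circ> s) \<longlonglongrightarrow> l"
    using bounded_imp_convergent_subsequence[of "x \<circ> r"] by metis
  then have "l \<in> limit_points x"
    unfolding limit_points_def using strict_mono_o[OF assms(2) sl(1)] by (auto simp: comp_assoc)
  with sl show ?thesis by (rule that)
qed

text \<open>Otherwise the infinitely many iterates farther than \<open>\<gamma>\<close> away would
  have a subsequence converging to a limit point, which is at distance \<open>0\<close>.\<close>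

lemma infdist_limit_points_eventually_le:
  fixes x :: "nat \<Rightarrow> real^'n"
  assumes "bounded (range x)" "0 < \<gamma>"
  shows "\<forall>\<^sub>F k in sequentially. infdist (x k) (limit_points x) \<le> \<gamma>"
proof (rule ccontr)
  let ?X = "limit_points x"
  assume "\<not> ?thesis"
  then have "infinite {k. \<not> infdist (x k) ?X \<le> \<gamma>}"
    by (simp add: cofinite_eq_sequentially[symmetric] eventually_cofinite)
  from infinite_enumerate[OF this] obtain r :: "nat \<Rightarrow> nat"
    where r: "strict_mono r" "\<forall>k. r k \<in> {k. \<not> infdist (x k) ?X \<le> \<gamma>}"
    by blast
  obtain s l where "strict_mono s" and sl: "(x \<circ> r \<circ> s) \<longlonglongrightarrow> l" "l \<in> ?X"
    using bounded_subseq_limit_point[OF assms(1) r(1)] .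
  have "(\<lambda>k. infdist ((x \<circ> r \<circ> s) k) ?X) \<longlonglongrightarrow> infdist l ?X"
    using sl(1) by (rule tendsto_infdist)
  moreover have "\<gamma> \<le> infdist ((x \<circ> r \<circ> s) k) ?X" for k
    using r(2)[rule_format, of "s k"] by simp
  ultimately have "\<gamma> \<le> infdist l ?X" by (intro LIMSEQ_le_const) auto
  with sl(2) \<open>0 < \<gamma>\<close> show False by simp
qed

text \<open>Continuity gives the limit \<open>Fstar\<close> along some further subsequence;
  monotonicity extends it to all of \<open>r\<close>.\<close>

lemma decseq_subseq_tendsto_limit_point_value:
  fixes x :: "nat \<Rightarrow> real^'n" and F :: "real^'n \<Rightarrow> real" and r :: "nat \<Rightarrow> nat"
  assumes "bounded (range x)" "continuous_on UNIV F" "\<And>z. z \<in> limit_points x \<Longrightarrow> F z = Fstar"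
    and "strict_mono r" and dec: "decseq (\<lambda>k. F (x (r k)))"
  shows "(\<lambda>k. F (x (r k))) \<longlonglongrightarrow> Fstar"
proof -
  obtain s l where sl: "strict_mono s" "(x \<circ> r \<circ> s) \<longlonglongrightarrow> l" "l \<in> limit_points x"
    using bounded_subseq_limit_point[OF assms(1,4)] .
  have "(\<lambda>k. F ((x \<circ> r \<circ> s) k)) \<longlonglongrightarrow> F l"
    using assms(2)
    by (intro isCont_tendsto_compose[OF _ sl(2)]) (simp add: continuous_on_eq_continuous_at)
  then have sub: "((\<lambda>k. F (x (r k))) \<circ> s) \<longlonglongrightarrow> Fstar"
    using assms(3)[OF sl(3)] by (simp add: o_def)
  have "Fstar \<le> F (x (r k))" for k
  proof (rule LIMSEQ_le_const2[OF sub], intro exI allI impI)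
    fix n assume "k \<le> n"
    also have "n \<le> s n" by (rule seq_suble[OF sl(1)])
    finally show "((\<lambda>k. F (x (r k))) \<circ> s) n \<le> F (x (r k))"
      using decseqD[OF dec] by simp
  qed
  then obtain L where "(\<lambda>k. F (x (r k))) \<longlonglongrightarrow> L"
    using decseq_convergent[OF dec] by blast
  moreover from LIMSEQ_subseq_LIMSEQ[OF this sl(1)] sub have "L = Fstar"
    by (rule LIMSEQ_unique)
  ultimately show ?thesis by simp
qed

text \<open>Raising the KL inequality to the power \<open>2 / q\<close> turns
  \<open>g powr q\<close> into \<open>g\<^sup>2\<close>, which the descent condition bounds by the
  decrease. The KL inequality is available only at a positive gap; a zero gap makes the right-hand
  side \<open>0\<close>.\<close>

lemma KL_descent:
  fixes \<Delta> \<Delta>' g C \<sigma> q :: real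
  assumes "0 \<le> \<Delta>'" "0 \<le> \<Delta>" "0 < C" "0 < \<sigma>" "0 < q" "0 \<le> g"
    and descent: "\<Delta> - \<Delta>' \<ge> C * g\<^sup>2" and KL: "0 < \<Delta> \<Longrightarrow> \<Delta> \<le> \<sigma> * g powr q"
  shows "\<Delta> - \<Delta>' \<ge> C * \<sigma> powr (- 2 / q) * \<Delta> powr (2 / q)"
proof (cases "\<Delta> = 0")
  case True
  have "0 \<le> C * g\<^sup>2" using \<open>0 < C\<close> by simp
  then show ?thesis using True descent by simp
next
  case False
  then have "0 < \<Delta>" using assms by simp
  then have "0 < g" using KL \<open>0 \<le> g\<close> by (cases "g = 0") auto
  have "\<Delta> powr (2 / q) \<le> (\<sigma> * g powr q) powr (2 / q)"
    using KL \<open>0 < \<Delta>\<close> \<open>0 < q\<close> by (intro powr_mono2) auto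
  also have "\<dots> = \<sigma> powr (2 / q) * g\<^sup>2"
    using assms \<open>0 < g\<close> by (simp add: powr_mult powr_powr powr_numeral)
  finally have "\<sigma> powr (- 2 / q) * \<Delta> powr (2 / q) \<le> \<sigma> powr (- 2 / q) * (\<sigma> powr (2 / q) * g\<^sup>2)"
    by (intro mult_left_mono) auto
  also have "\<dots> = g\<^sup>2"
    using \<open>0 < \<sigma>\<close> by (simp add: powr_minus)
  finally have "C * \<sigma> powr (- 2 / q) * \<Delta> powr (2 / q) \<le> C * g\<^sup>2"
    using \<open>0 < C\<close> by (simp add: mult.assoc)
  then show ?thesis using descent by linarith
qed

theorem theorem6p9:
  fixes f \<psi> F :: "real^'n \<Rightarrow> real"
    and U :: "real^'n^'n" and J :: "nat \<Rightarrow> 'n set" and N :: nat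
    and L \<eta> :: "nat \<Rightarrow> real" and H\<psi> L\<psi> :: real and p :: nat
    and x :: "nat \<Rightarrow> real^'n"
    and C Fstar q \<gamma> \<epsilon> \<sigma> :: real
  assumes F: "F = (\<lambda>z. f z + \<psi> z)"
    and U: "column_permutation_of_identity U"
    and J: "column_split J N"
    and f_diff: "\<forall>z. f differentiable (at z)"
    and A1: "assumption_A1 U J N f L"
    and A2: "twice_cont_diff \<psi>"
    and A3: "assumption_A3 F"
    and \<eta>: "\<forall>i\<in>{1..N}. 0 < \<eta> i"
    and algorithm: "cpg_sequence U J N f \<psi> L \<eta> (cyclic_index N) x \<or>
                    cgd_sequence U J N f \<psi> L \<eta> H\<psi> p L\<psi> (cyclic_index N) x"
    and bounded: "bounded (range x)"
    and C: "0 < C"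
    and descent: "\<forall>k. F (x k) - F (x (k + N)) \<ge> C * (norm (grad F (x k)))\<^sup>2"
    and q: "1 < q"
    and KL: "KL_property F (limit_points x) Fstar q \<gamma> \<epsilon> \<sigma>"
  shows "\<exists>kbar>0.
    (q < 2 \<longrightarrow>
       (\<forall>k\<ge>kbar. F (x (k * N)) - Fstar \<le>
          (F (x (kbar * N)) - Fstar) /
          ((2 - q) / q * C * \<sigma> powr (- 2 / q) * (F (x (kbar * N)) - Fstar) powr ((2 - q) / q)
             * real (k - kbar) + 1) powr (q / (2 - q)))) \<and>
    (q = 2 \<longrightarrow>
       (\<forall>k\<ge>kbar. F (x (k * N)) - Fstar \<le>
          (1 - C * inverse \<sigma>) ^ (k - kbar) * (F (x (kbar * N)) - Fstar))) \<and>
    (q > 2 \<longrightarrow>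
       (\<forall>k>kbar. F (x (k * N)) > Fstar \<longrightarrow>
          F (x (k * N)) - Fstar \<le>
          1 / (1 + C * \<sigma> powr (- 2 / q) * (F (x (k * N)) - Fstar) powr (2 / q - 1))
            * (F (x ((k - 1) * N)) - Fstar)))"
proof -
  \<comment> \<open>With \<open>N = 0\<close> the blocks would have an empty union, but the index
    type is nonempty.\<close>
  have "0 < N"
  proof (rule ccontr)
    assume "\<not> 0 < N"
    then show False using J by (auto simp: column_split_def)
  qed
  then have sm: "strict_mono (\<lambda>k. k * N)" by (auto simp: strict_mono_def)
  define \<Delta> where "\<Delta> k = F (x (k * N)) - Fstar" for k
  define g where "g k = norm (grad F (x (k * N)))" for k
  have descent': "\<Delta> k - \<Delta> (Suc k) \<ge> C * (g k)\<^sup>2" for k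
    using descent[rule_format, of "k * N"] by (simp add: \<Delta>_def g_def add.commute)
  have KLpos: "0 < \<gamma>" "0 < \<epsilon>" "0 < \<sigma>" and KLconst: "\<And>z. z \<in> limit_points x \<Longrightarrow> F z = Fstar"
    and KLineq: "\<And>z. infdist z (limit_points x) \<le> \<gamma> \<Longrightarrow> Fstar < F z \<Longrightarrow> F z < Fstar + \<epsilon> \<Longrightarrow>
        F z - Fstar \<le> \<sigma> * norm (grad F z) powr q"
    using KL unfolding KL_property_def by blast+
  have cont: "continuous_on UNIV F"
    unfolding F continuous_on_eq_continuous_at[OF open_UNIV]
    using f_diff A2[unfolded twice_cont_diff_def]
    by (auto intro!: continuous_intros differentiable_imp_continuous_within)
  have dec\<Delta>: "decseq \<Delta>"
  proof (rule decseq_SucI)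
    fix k
    have "0 \<le> C * (g k)\<^sup>2" using C by simp
    then show "\<Delta> (Suc k) \<le> \<Delta> k" using descent'[of k] by linarith
  qed
  then have "decseq (\<lambda>k. F (x (k * N)))"
    by (simp add: \<Delta>_def decseq_def)
  from decseq_subseq_tendsto_limit_point_value[OF bounded cont KLconst sm this]
  have lim: "\<Delta> \<longlonglongrightarrow> 0"
    by (simp add: \<Delta>_def[abs_def] LIM_zero)
  have nonneg: "0 \<le> \<Delta> k" for k
    using decseq_ge[OF dec\<Delta> lim] .
  \<comment> \<open>These are the conditions of the KL inequality other than positivity of the gap,
    so \<open>K\<close> depends on \<open>\<gamma>\<close> and \<open>\<epsilon>\<close>.\<close>
  have "\<forall>\<^sub>F k in sequentially. infdist (x (k * N)) (limit_points x) \<le> \<gamma> \<and> \<Delta> k < \<epsilon>"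
    by (intro eventually_conj order_tendstoD(2)[OF lim KLpos(2)]
        eventually_compose_filterlim[OF infdist_limit_points_eventually_le[OF bounded KLpos(1)]
          filterlim_subseq[OF sm]])
  then obtain K where K: "\<And>k. K \<le> k \<Longrightarrow> infdist (x (k * N)) (limit_points x) \<le> \<gamma> \<and> \<Delta> k < \<epsilon>"
    by (auto simp: eventually_sequentially)
  \<comment> \<open>The successor ensures \<open>kbar > 0\<close>.\<close>
  define kbar where "kbar = Suc K"
  define c where "c = C * \<sigma> powr (- 2 / q)"
  have "0 < c" using C KLpos by (simp add: c_def)
  have rec: "\<Delta> k - \<Delta> (Suc k) \<ge> c * \<Delta> k powr (2 / q)" if "kbar \<le> k" for k
    unfolding c_def
  proof (rule KL_descent[OF nonneg nonneg C KLpos(3) _ _ descent'])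
    show "0 < \<Delta> k \<Longrightarrow> \<Delta> k \<le> \<sigma> * g k powr q"
      using KLineq[of "x (k * N)"] K[of k] that by (simp add: kbar_def \<Delta>_def g_def)
  qed (use q in \<open>auto simp: g_def\<close>)
  have i: "\<Delta> k \<le> \<Delta> kbar /
      ((2 - q) / q * C * \<sigma> powr (- 2 / q) * \<Delta> kbar powr ((2 - q) / q) * real (k - kbar) + 1)
        powr (q / (2 - q))" if "q < 2" "kbar \<le> k" for k
  proof -
    \<comment> \<open>The sublinear rate is applied with \<open>s = (2 - q) / q\<close>, positive
      for \<open>q < 2\<close>, to the sequence shifted by \<open>kbar\<close>.\<close>
    have "1 + (2 - q) / q = 2 / q" using q by (simp add: field_simps)
    then have "\<Delta> (kbar + m) - \<Delta> (kbar + Suc m) \<ge> c * \<Delta> (kbar + m) powr (1 + (2 - q) / q)" for m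
      using rec[of "kbar + m"] by simp
    from sublinear_rate[of "\<lambda>m. \<Delta> (kbar + m)", OF nonneg _ \<open>0 < c\<close> this, of "k - kbar"]
    show ?thesis using that q by (simp add: c_def mult.assoc)
  qed
  have ii: "\<Delta> k \<le> (1 - C * inverse \<sigma>) ^ (k - kbar) * \<Delta> kbar" if "q = 2" "kbar \<le> k" for k
  proof -
    have "c = C * inverse \<sigma>" using that KLpos by (simp add: c_def powr_minus)
    then have "\<Delta> (kbar + Suc m) \<le> (1 - C * inverse \<sigma>) * \<Delta> (kbar + m)" for m
      using rec[of "kbar + m"] nonneg[of "kbar + m"] that by (simp add: algebra_simps)
    from linear_rate[of "\<lambda>m. \<Delta> (kbar + m)", OF nonneg this, of "k - kbar"]
    show ?thesis using that by simp
  qed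
  \<comment> \<open>The recursion is used at \<open>k - 1\<close>, hence the strict bound
    \<open>kbar < k\<close>.\<close>
  have iii: "\<Delta> k \<le> 1 / (1 + C * \<sigma> powr (- 2 / q) * \<Delta> k powr (2 / q - 1)) * \<Delta> (k - 1)"
    if "q > 2" "kbar < k" "0 < \<Delta> k" for k
    unfolding c_def[symmetric]
    by (rule superlinear_rate) (use that q \<open>0 < c\<close> rec[of "k - 1"] in auto)
  show ?thesis
    using i ii iii unfolding \<Delta>_def by (intro exI[of _ kbar]) (auto simp: kbar_def)
qed

end
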